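(* Let $X$ and $Z$ be Hausdorff topological vector spaces, let $C\subseteq Z$ be a convex and pointed cone with nonempty interior and let $K$ be a nonempty convex subset of $X$. Assume that the bifunctions $f,g:K\times K\to Z$ satisfy: (i) there exists a nonempty compact convex subset $K_0$ of $K$ with the property that for every $x\in K_0\setminus\operatorname{core}_K K_0$ there exists $y_0\in\operatorname{core}_K K_0$ such that $f(x,y_0)+g(x,y_0)\in-C$; and, for this set $K_0$, (ii) for every $y\in K_0$ it holds that for every $x\in K_0$ and every net $(x_\alpha)\subseteq K_0$ with $\lim x_\alpha=x$ there exists a net $(z_\alpha)\subseteq Z$ with $\lim z_\alpha=z$ such that $f(x_\alpha,y)+g(x_\alpha,y)-z_\alpha\in-C$ and $f(x,y)+g(x,y)-z\in C$; (iii) $f$ is $C$-essentially quasimonotone relative to the second variable on $K_0$, that is, for all $y_1,\dots,y_n\in K_0$ and all $\lambda_1,\dots,\lambda_n\ge0$ with $\sum_{i=1}^n\lambda_i=1$ one has $\sum_{i=1}^n\lambda_i f\left(\sum_{j=1}^n\lambda_j y_j,\,y_i\right)\notin-\operatorname{int}C$; (iv) the mappings $y\mapsto g(x,y)$ and $y\mapsto f(x,y)$ are $C$-convex on $K$ for all $x\in K_0$; (v) for every $x\in K_0$, $f(x,x)\in(-C)\setminus(-\operatorname{int}C)$ and $g(x,x)=0$. Then there exists $x_0\in K$ such that $f(x_0,y)+g(x_0,y)\notin-\operatorname{int}C$ for all $y\in K$.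
   Context: All spaces are real. A cone $C$ satisfies $tc\in C$ for all $c\in C$, $t\ge 0$; it is convex if $C+C=C$ and pointed if $C\cap(-C)=\{0\}$ ($C$ is not assumed closed). $\operatorname{int}C$ is the interior of $C$. A map $h:K\to Z$ ($K$ convex) is $C$-convex if $th(x)+(1-t)h(y)-h(tx+(1-t)y)\in C$ for all $x,y\in K$, $t\in[0,1]$. For convex sets $U\subseteq V\subseteq X$, the algebraic interior of $U$ relative to $V$ is $\operatorname{core}_V U=\{u\in U: U\cap\,]u,v]\ne\emptyset\ \text{for all } v\in V\}$, where $]u,v]=\{u+t(v-u): t\in\,]0,1]\}$. *)

theory Defs
  imports "HOL-Analysis.Analysis"
begin

text \<open>Joint continuity of scalar multiplication is phrased like the class axiom for addition in
  \<^class>\<open>topological_monoid_add\<close>.\<close>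

class hausdorff_real_tvs = real_vector + topological_ab_group_add + t2_space +
  assumes tendsto_scaleR_Pair:
    "filterlim (\<lambda>p. fst p *\<^sub>R snd p) (nhds (c *\<^sub>R x)) (nhds c \<times>\<^sub>F nhds x)"

instance real_normed_vector \<subseteq> hausdorff_real_tvs
proof
  fix c :: real and x :: 'a
  show "filterlim (\<lambda>p. fst p *\<^sub>R snd p) (nhds (c *\<^sub>R x)) (nhds c \<times>\<^sub>F nhds x)"
    by (intro tendsto_scaleR filterlim_fst filterlim_snd)
qed

definition pointed_convex_cone :: "'z::real_vector set \<Rightarrow> bool" where
  "pointed_convex_cone C \<longleftrightarrow> cone C \<and> C + C = C \<and> C \<inter> uminus ` C = {0}"

definition cone_convex_on ::
  "'z::real_vector set \<Rightarrow> 'x::real_vector set \<Rightarrow> ('x \<Rightarrow> 'z) \<Rightarrow> bool" where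
  "cone_convex_on C K h \<longleftrightarrow>
     (\<forall>x\<in>K. \<forall>y\<in>K. \<forall>t\<in>{0..1}. t *\<^sub>R h x + (1 - t) *\<^sub>R h y - h (t *\<^sub>R x + (1 - t) *\<^sub>R y) \<in> C)"

definition left_open_segment :: "'x::real_vector \<Rightarrow> 'x \<Rightarrow> 'x set" where
  "left_open_segment u v = {u + t *\<^sub>R (v - u) | t. t \<in> {0<..1}}"

text \<open>Note that \<^term>\<open>left_open_segment u u\<close> is \<open>{u}\<close>, not the empty set.\<close>

definition core_rel :: "'x::real_vector set \<Rightarrow> 'x set \<Rightarrow> 'x set" where
  "core_rel V U = {u \<in> U. \<forall>v\<in>V. U \<inter> left_open_segment u v \<noteq> {}}"

definition essentially_quasimonotone_on ::
  "'z::{real_vector, topological_space} set \<Rightarrow> 'x::real_vector set \<Rightarrow> ('x \<Rightarrow> 'x \<Rightarrow> 'z) \<Rightarrow> bool" where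
  "essentially_quasimonotone_on C K f \<longleftrightarrow>
     (\<forall>(n::nat) (y :: nat \<Rightarrow> 'x) (l :: nat \<Rightarrow> real).
        (\<forall>i\<in>{1..n}. y i \<in> K \<and> 0 \<le> l i) \<and> (\<Sum>i=1..n. l i) = 1 \<longrightarrow>
        (\<Sum>i=1..n. l i *\<^sub>R f (\<Sum>j=1..n. l j *\<^sub>R y j) (y i)) \<notin> uminus ` interior C)"

definition directed_set :: "'i set \<Rightarrow> ('i \<Rightarrow> 'i \<Rightarrow> bool) \<Rightarrow> bool" where
  "directed_set D le \<longleftrightarrow> D \<noteq> {} \<and> (\<forall>a\<in>D. le a a) \<and>
     (\<forall>a\<in>D. \<forall>b\<in>D. \<forall>c\<in>D. le a b \<longrightarrow> le b c \<longrightarrow> le a c) \<and>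
     (\<forall>a\<in>D. \<forall>b\<in>D. \<exists>c\<in>D. le a c \<and> le b c)"

text \<open>The filter generated by the tails of a directed set: a net \<open>u\<close> over \<open>(D, le)\<close> converges to
  \<open>l\<close> iff \<open>(u \<longlongrightarrow> l) (tails D le)\<close>. Only the values of \<open>u\<close> on \<open>D\<close> matter.\<close>

definition tails :: "'i set \<Rightarrow> ('i \<Rightarrow> 'i \<Rightarrow> bool) \<Rightarrow> 'i filter" where
  "tails D le = (INF a\<in>D. principal {b \<in> D. le a b})"

lemma eventually_tails:
  assumes "directed_set D le"
  shows "eventually P (tails D le) \<longleftrightarrow> (\<exists>a\<in>D. \<forall>b\<in>D. le a b \<longrightarrow> P b)"
proof -
  have "eventually P (tails D le) \<longleftrightarrow> (\<exists>a\<in>D. eventually P (principal {b \<in> D. le a b}))"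
    unfolding tails_def
  proof (rule eventually_INF_base)
    show "D \<noteq> {}" using assms by (simp add: directed_set_def)
    fix a b assume "a \<in> D" "b \<in> D"
    then obtain c where "c \<in> D" "le a c" "le b c"
      using assms unfolding directed_set_def by blast
    moreover have "le a d \<and> le b d" if "d \<in> D" "le c d" for d
      using assms that calculation \<open>a \<in> D\<close> \<open>b \<in> D\<close> unfolding directed_set_def by blast
    ultimately show "\<exists>c\<in>D. principal {d \<in> D. le c d}
        \<le> inf (principal {d \<in> D. le a d}) (principal {d \<in> D. le b d})"
      by (intro bexI[of _ c]) auto
  qed
  then show ?thesis by (auto simp: eventually_principal)
qed

lemma net_tendsto_iff:
  assumes "directed_set D le"
  shows "(u \<longlongrightarrow> l) (tails D le) \<longleftrightarrow>
    (\<forall>U. open U \<longrightarrow> l \<in> U \<longrightarrow> (\<exists>a\<in>D. \<forall>b\<in>D. le a b \<longrightarrow> u b \<in> U))"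
  using assms by (simp add: tendsto_def eventually_tails)

text \<open>HOL cannot quantify over types, so "every net in a space of type \<open>'x\<close>" has to fix a type of
  indices. We use \<open>'x set \<times> 'x\<close>, over which every proper filter on \<open>'x\<close> is the image of a tails
  filter (take the pairs \<open>(A, a)\<close> with \<open>a \<in> A\<close> and \<open>A\<close> in the filter, ordered by reverse
  inclusion of \<open>A\<close>). In particular nets over this type determine closures. A hypothesis about all
  nets only becomes weaker by this restriction.\<close>

lemma closure_iff_net:
  fixes S :: "'x::topological_space set"
  shows "x \<in> closure S \<longleftrightarrow>
    (\<exists>(D :: ('x set \<times> 'x) set) le u.
       directed_set D le \<and> (\<forall>a\<in>D. u a \<in> S) \<and> (u \<longlongrightarrow> x) (tails D le))" (is "_ \<longleftrightarrow> ?R")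
proof
  assume x: "x \<in> closure S"
  define D where "D = {(U, a). open U \<and> x \<in> U \<and> a \<in> U \<inter> S}"
  define le where "le = (\<lambda>(p :: 'x set \<times> 'x) (q :: 'x set \<times> 'x). fst q \<subseteq> fst p)"
  have ex: "\<exists>a. a \<in> U \<inter> S" if "open U" "x \<in> U" for U
    proof -
    have "U \<inter> S \<noteq> {}"
      using x that open_Int_closure_eq_empty[of U S] by auto
    then show ?thesis by auto
  qed
  have up: "\<exists>c\<in>D. le a c \<and> le b c" if "a \<in> D" "b \<in> D" for a b
  proof -
    have o: "open (fst a \<inter> fst b)" "x \<in> fst a \<inter> fst b" using that by (auto simp: D_def)
    then obtain s where "s \<in> fst a \<inter> fst b \<inter> S" using ex by blast
    with o have "(fst a \<inter> fst b, s) \<in> D" by (simp add: D_def)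
    then show ?thesis by (rule rev_bexI) (simp add: le_def)
  qed
  obtain s where "s \<in> UNIV \<inter> S" using ex[of UNIV] by blast
  then have "(UNIV, s) \<in> D" by (simp add: D_def)
  then have ne: "D \<noteq> {}" by blast
  have dir: "directed_set D le"
    unfolding directed_set_def
  proof (intro conjI ballI impI)
    fix a b c assume "le a b" "le b c"
    then show "le a c" unfolding le_def by (rule subset_trans[rotated])
  qed (use ne up in \<open>simp_all add: le_def\<close>)
  have "(snd \<longlongrightarrow> x) (tails D le)"
    unfolding net_tendsto_iff[OF dir]
  proof (intro allI impI)
    fix U assume U: "open U" "x \<in> U"
    then obtain s where "s \<in> U \<inter> S" using ex by blast
    with U have "(U, s) \<in> D" by (simp add: D_def)
    moreover have "\<forall>b\<in>D. le (U, s) b \<longrightarrow> snd b \<in> U" by (auto simp: D_def le_def)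
    ultimately show "\<exists>a\<in>D. \<forall>b\<in>D. le a b \<longrightarrow> snd b \<in> U" by (rule rev_bexI)
  qed
  moreover have "\<forall>a\<in>D. snd a \<in> S" by (auto simp: D_def)
  ultimately show ?R using dir by (intro exI[of _ D] exI[of _ le] exI[of _ snd] conjI)
next
  assume ?R
  then obtain D :: "('x set \<times> 'x) set" and le and u where
    dir: "directed_set D le" and S: "\<forall>a\<in>D. u a \<in> S" and lim: "(u \<longlongrightarrow> x) (tails D le)"
    by (elim exE conjE)
  have *: "\<exists>a\<in>S. a \<in> U" if U: "open U" "x \<in> U" for U
  proof -
    have "\<exists>a\<in>D. \<forall>b\<in>D. le a b \<longrightarrow> u b \<in> U"
      using lim U by (simp add: net_tendsto_iff[OF dir])
    then obtain a where a: "a \<in> D" "\<forall>b\<in>D. le a b \<longrightarrow> u b \<in> U" ..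
    moreover have "le a a" using dir a(1) by (simp add: directed_set_def)
    ultimately have "u a \<in> U" "u a \<in> S" using S by simp_all
    then show ?thesis ..
  qed
  from *[of "- closure S"] show "x \<in> closure S"
    using closure_subset[of S] by auto
qed

end

theory Submission
  imports Defs
begin

text \<open>Write \<open>F = f + g\<close> and call a point \<open>y\<close> bad for \<open>x\<close> if \<open>F x y\<close> lies in \<open>- interior C\<close>.
  The proof finds a point of \<open>K0\<close> for which no point of \<open>K0\<close> is bad, and then shows that the same
  point works against all of \<open>K\<close>.

  On \<open>K0\<close>, let \<open>G y\<close> be the set of those \<open>x\<close> for which \<open>y\<close> is not bad. Hypothesis (ii) is a form of
  upper semicontinuity of \<open>F\<close> in the first variable and makes \<open>G y\<close> closed, hence compact
  (\<open>closed_equilibrium_set\<close>). If a convex combination \<open>x\<close> of \<open>y\<^sub>1, \<dots>, y\<^sub>n\<close> were in no \<open>G y\<^sub>i\<close>, the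
  combination of the values \<open>F x y\<^sub>i\<close> would lie in \<open>- interior C\<close>; since the combination of the
  \<open>g x y\<^sub>i\<close> dominates \<open>g x x = 0\<close> by convexity, the combination of the \<open>f x y\<^sub>i\<close> would lie there too,
  against essential quasimonotonicity (\<open>equilibrium_set_kkm\<close>). So \<open>G\<close> satisfies the hypotheses of the
  Knaster-Kuratowski-Mazurkiewicz theorem, and the sets \<open>G y\<close> have a common point \<open>x0\<close>.

  For the passage to \<open>K\<close> there is a point \<open>y0\<close> of the relative core with \<open>F x0 y0\<close> in \<open>- C\<close>: by (i) if
  \<open>x0\<close> is outside the core, and otherwise \<open>y0 = x0\<close> by (v). If some \<open>y\<close> in \<open>K\<close> were bad for \<open>x0\<close>,
  convexity of \<open>F x0\<close> would make every point of the half-open segment from \<open>y0\<close> to \<open>y\<close> bad, but that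
  segment meets \<open>K0\<close> (\<open>equilibrium_extends_from_core\<close>).

  The Knaster-Kuratowski-Mazurkiewicz theorem itself needs a topological input in every finite
  dimension. It comes from Kuhn's parity argument \<open>kuhn_combinatorial\<close> for labelled grids, whose
  dimension is a natural number. The cube is carried onto the simplex of convex weights by
  stick-breaking, which sends the faces of the cube into faces of the simplex in just the way
  that Kuhn's boundary conditions on labels demand.\<close>

section \<open>The Knaster-Kuratowski-Mazurkiewicz principle\<close>

text \<open>Kuhn's parity argument uses one label in \<open>{0, 1}\<close> per coordinate and reduces these to the index of
  the first \<open>1\<close>. Here it is rephrased for a single label in \<open>{..n}\<close>: the 0-1 labels are chosen so that
  the reduced label is the given one. A label \<open>j\<close> is forbidden on the face \<open>x j = 0\<close>, and labels above
  \<open>j\<close> are forbidden on the opposite face. The conclusion gives the lower corner \<open>b\<close> of a cell with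
  all labels.\<close>

lemma kuhn_fully_labelled_cell:
  fixes lbl :: "(nat \<Rightarrow> nat) \<Rightarrow> nat"
  assumes p: "0 < p"
    and le: "\<And>x. \<forall>j. x j \<le> p \<Longrightarrow> lbl x \<le> n"
    and bottom: "\<And>x j. \<forall>j. x j \<le> p \<Longrightarrow> j < n \<Longrightarrow> x j = 0 \<Longrightarrow> lbl x \<noteq> j"
    and top: "\<And>x j. \<forall>j. x j \<le> p \<Longrightarrow> j < n \<Longrightarrow> x j = p \<Longrightarrow> lbl x \<le> j"
  obtains b s where "\<And>j. b j \<le> p"
    and "\<And>i. i \<le> n \<Longrightarrow> lbl (s i) = i"
    and "\<And>i j. i \<le> n \<Longrightarrow> s i j \<le> p"
    and "\<And>i j. i \<le> n \<Longrightarrow> b j \<le> s i j \<and> s i j \<le> Suc (b j)"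
proof -
  \<comment> \<open>Beyond the index \<open>lbl x\<close> the reduction ignores the labels; the value \<open>1\<close> at \<open>x j = p\<close> only
    serves the boundary condition there.\<close>
  define lab where
    "lab x j = (if j < lbl x then 0 else if j = lbl x \<or> x j = p then 1 else 0 :: nat)" for x j
  have reduced: "reduced n (lab x) = lbl x" if "\<forall>j. x j \<le> p" for x
    by (rule reduced_labelling_unique) (auto simp: lab_def le that)
  have "odd (card {S. ksimplex p n S \<and> (reduced n \<circ> lab) ` S = {..n}})"
  proof (rule kuhn_combinatorial[OF p])
    show "\<forall>x j. (\<forall>j. x j \<le> p) \<and> j < n \<and> x j = 0 \<longrightarrow> lab x j = 0"
      using bottom p by (auto simp: lab_def)
    show "\<forall>x j. (\<forall>j. x j \<le> p) \<and> j < n \<and> x j = p \<longrightarrow> lab x j = 1"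
      using top by (auto simp: lab_def not_less[symmetric])
  qed
  then have "{S. ksimplex p n S \<and> (reduced n \<circ> lab) ` S = {..n}} \<noteq> {}"
    by (rule odd_card_imp_not_empty)
  then obtain S b u where S: "kuhn_simplex p n b u S" and rl: "(reduced n \<circ> lab) ` S = {..n}"
    by (auto elim: ksimplex.cases)
  interpret kuhn_simplex p n b u S by fact
  have "\<exists>x\<in>S. lbl x = i" if i: "i \<le> n" for i
  proof -
    have "i \<in> (reduced n \<circ> lab) ` S" using i by (simp only: rl atMost_iff)
    then obtain x where x: "x \<in> S" "i = reduced n (lab x)" by auto
    then have "\<forall>j. x j \<le> p" using s_le_p by blast
    with x reduced show ?thesis by auto
  qed
  then obtain s where s: "\<And>i. i \<le> n \<Longrightarrow> s i \<in> S \<and> lbl (s i) = i" by metis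
  show ?thesis
  proof (rule that[of b s])
    show "b j \<le> p" for j using s_le_p[OF base_in_s] .
  qed (use s s_le_p base_le le_Suc_base in auto)
qed

lemma tendsto_fun_coordinatewise:
  fixes f :: "'a \<Rightarrow> 'i \<Rightarrow> 'b::topological_space"
  assumes "\<And>i. ((\<lambda>a. f a i) \<longlongrightarrow> l i) F"
  shows "(f \<longlongrightarrow> l) F"
proof -
  have "limitin (product_topology (\<lambda>i. euclidean) UNIV) f l F"
    using assms by (subst limitin_componentwise) simp
  then show ?thesis by (simp add: euclidean_product_topology)
qed

lemma compact_hilbert_cube: "compact {t :: nat \<Rightarrow> real. \<forall>j. t j \<in> {0..1}}"
proof -
  have "compactin (product_topology (\<lambda>i::nat. euclidean) UNIV) (PiE UNIV (\<lambda>i. {0..1::real}))"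
    by (subst compactin_PiE) simp
  moreover have "{t :: nat \<Rightarrow> real. \<forall>j. t j \<in> {0..1}} = PiE UNIV (\<lambda>i. {0..1})" by auto
  ultimately show ?thesis by (simp add: euclidean_product_topology)
qed

text \<open>A version of the Knaster-Kuratowski-Mazurkiewicz theorem on the cube: ever finer grids have cells
  with all labels, and a limit of such cells lies in every \<open>A i\<close>. Points are sequences and only the
  first \<open>n\<close> coordinates enter the boundary conditions; working in the Hilbert cube keeps the
  dimension a natural number, and compactness and metrizability still allow to choose a convergent
  subsequence.\<close>

lemma kkm_cube:
  fixes A :: "nat \<Rightarrow> (nat \<Rightarrow> real) set"
  assumes closed: "\<And>i. i \<le> n \<Longrightarrow> closed (A i)"
    and cover: "\<And>t. \<forall>j. t j \<in> {0..1} \<Longrightarrow>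
      \<exists>i\<le>n. t \<in> A i \<and> (i < n \<longrightarrow> t i \<noteq> 0) \<and> (\<forall>j<i. t j \<noteq> 1)"
  obtains t where "\<And>j. t j \<in> {0..1}" "\<And>i. i \<le> n \<Longrightarrow> t \<in> A i"
proof -
  define Q where "Q = {t :: nat \<Rightarrow> real. \<forall>j. t j \<in> {0..1}}"
  define \<iota> where "\<iota> m x = (\<lambda>j. real (x j) / real (Suc m))" for m and x :: "nat \<Rightarrow> nat"
  have \<iota>_Q: "\<iota> m x \<in> Q" if "\<And>j. x j \<le> Suc m" for m x
    using that by (auto simp: Q_def \<iota>_def divide_simps simp flip: of_nat_Suc)
  have "\<exists>b s. \<iota> m b \<in> Q \<and> (\<forall>i\<le>n. \<iota> m (s i) \<in> A i \<and> (\<forall>j. b j \<le> s i j \<and> s i j \<le> Suc (b j)))" for m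
  proof -
    obtain lbl where lbl: "lbl x \<le> n \<and> \<iota> m x \<in> A (lbl x) \<and> (lbl x < n \<longrightarrow> \<iota> m x (lbl x) \<noteq> 0) \<and>
        (\<forall>j<lbl x. \<iota> m x j \<noteq> 1)" if "\<forall>j. x j \<le> Suc m" for x
    proof -
      have "\<forall>x. \<exists>i. (\<forall>j. x j \<le> Suc m) \<longrightarrow> i \<le> n \<and> \<iota> m x \<in> A i \<and> (i < n \<longrightarrow> \<iota> m x i \<noteq> 0) \<and>
        (\<forall>j<i. \<iota> m x j \<noteq> 1)"
        using cover \<iota>_Q unfolding Q_def by blast
      from choice[OF this] that show thesis by blast
    qed
    obtain b s where bs: "\<And>j. b j \<le> Suc m" "\<And>i. i \<le> n \<Longrightarrow> lbl (s i) = i"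
      "\<And>i j. i \<le> n \<Longrightarrow> s i j \<le> Suc m" "\<And>i j. i \<le> n \<Longrightarrow> b j \<le> s i j \<and> s i j \<le> Suc (b j)"
    proof (rule kuhn_fully_labelled_cell[of "Suc m" lbl n])
      show "lbl x \<noteq> j" if "\<forall>j. x j \<le> Suc m" "j < n" "x j = 0" for x j
        using lbl[OF that(1)] that by (auto simp: \<iota>_def)
      show "lbl x \<le> j" if "\<forall>j. x j \<le> Suc m" "j < n" "x j = Suc m" for x j
        using lbl[OF that(1)] that by (auto simp: \<iota>_def not_less[symmetric])
    qed (use lbl in auto)
    then show ?thesis using \<iota>_Q lbl by metis
  qed
  then obtain b s where b: "\<And>m. \<iota> m (b m) \<in> Q"
    and s: "\<And>m i. i \<le> n \<Longrightarrow> \<iota> m (s m i) \<in> A i"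
    and near: "\<And>m i j. i \<le> n \<Longrightarrow> b m j \<le> s m i j \<and> s m i j \<le> Suc (b m j)"
    by metis
  have "seq_compact Q" unfolding Q_def by (rule compact_imp_seq_compact[OF compact_hilbert_cube])
  then obtain t \<phi> where t: "t \<in> Q" and \<phi>: "strict_mono \<phi>"
    and lim: "((\<lambda>m. \<iota> m (b m)) \<circ> \<phi>) \<longlonglongrightarrow> t"
    using b by (meson seq_compactE)
  have "t \<in> A i" if i: "i \<le> n" for i
  proof (rule Lim_in_closed_set[OF closed[OF i]])
    show "(\<lambda>k. \<iota> (\<phi> k) (s (\<phi> k) i)) \<longlonglongrightarrow> t"
    proof (rule tendsto_fun_coordinatewise)
      fix j
      have lim_j: "(\<lambda>k. \<iota> (\<phi> k) (b (\<phi> k)) j) \<longlonglongrightarrow> t j"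
        using continuous_on_tendsto_compose[OF continuous_on_product_coordinates[of j] lim]
        by (simp add: o_def)
      have "(\<lambda>k. inverse (real (Suc (\<phi> k)))) \<longlonglongrightarrow> 0"
        using LIMSEQ_subseq_LIMSEQ[OF LIMSEQ_inverse_real_of_nat \<phi>] by (simp add: o_def)
      then have "(\<lambda>k. \<iota> (\<phi> k) (s (\<phi> k) i) j - \<iota> (\<phi> k) (b (\<phi> k)) j) \<longlonglongrightarrow> 0"
      proof (rule Lim_null_comparison[rotated], intro always_eventually allI)
        fix k
        have "real (b (\<phi> k) j) \<le> real (s (\<phi> k) i j)" "real (s (\<phi> k) i j) \<le> real (b (\<phi> k) j) + 1"
          using near[OF i, of "\<phi> k" j] by linarith+
        then have "\<bar>real (s (\<phi> k) i j) - real (b (\<phi> k) j)\<bar> * inverse (real (Suc (\<phi> k)))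
            \<le> 1 * inverse (real (Suc (\<phi> k)))"
          by (intro mult_right_mono) auto
        moreover have "\<iota> (\<phi> k) (s (\<phi> k) i) j - \<iota> (\<phi> k) (b (\<phi> k)) j
            = (real (s (\<phi> k) i j) - real (b (\<phi> k) j)) * inverse (real (Suc (\<phi> k)))"
          by (simp add: \<iota>_def divide_inverse left_diff_distrib)
        ultimately show "norm (\<iota> (\<phi> k) (s (\<phi> k) i) j - \<iota> (\<phi> k) (b (\<phi> k)) j)
            \<le> inverse (real (Suc (\<phi> k)))"
          by (simp add: abs_mult)
      qed
      from tendsto_add[OF this lim_j] show "(\<lambda>k. \<iota> (\<phi> k) (s (\<phi> k) i) j) \<longlonglongrightarrow> t j" by simp
    qed
  qed (use s i in auto)
  with t that show thesis unfolding Q_def by blast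
qed

text \<open>Break off the fraction \<open>t 0\<close> of a stick of length 1, then the fraction \<open>t 1\<close> of the rest, and so on;
  the last piece, of index \<open>n\<close>, is all that remains. The pieces are the weights of a point of the
  \<open>n\<close>-dimensional simplex. Piece \<open>i\<close> vanishes if \<open>t i = 0\<close>, and all pieces after \<open>j\<close> vanish if
  \<open>t j = 1\<close>.\<close>

definition stick_breaking :: "nat \<Rightarrow> (nat \<Rightarrow> real) \<Rightarrow> nat \<Rightarrow> real" where
  "stick_breaking n t i = (if i < n then t i else 1) * (\<Prod>j<i. 1 - t j)"

lemma sum_stick_breaking: "(\<Sum>i\<le>n. stick_breaking n t i) = 1"
proof -
  have "(\<Sum>i<k. t i * (\<Prod>j<i. 1 - t j)) = 1 - (\<Prod>j<k. 1 - t j)" for k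
    by (induction k) (auto simp: algebra_simps)
  moreover have "(\<Sum>i\<le>n. stick_breaking n t i)
      = (\<Sum>i<n. t i * (\<Prod>j<i. 1 - t j)) + (\<Prod>j<n. 1 - t j)"
    by (simp add: stick_breaking_def flip: lessThan_Suc_atMost)
  ultimately show ?thesis by simp
qed

lemma stick_breaking_nonneg:
  "(\<And>j. t j \<in> {0..1}) \<Longrightarrow> 0 \<le> stick_breaking n t i"
  unfolding stick_breaking_def by (intro mult_nonneg_nonneg prod_nonneg) auto

lemma continuous_on_stick_breaking: "continuous_on UNIV (\<lambda>t. stick_breaking n t i)"
  unfolding stick_breaking_def by (cases "i < n") (auto intro!: continuous_intros)

lemma continuous_on_scaleR_tvs:
  fixes x :: "'x::hausdorff_real_tvs"
  assumes "continuous_on S u"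
  shows "continuous_on S (\<lambda>s. u s *\<^sub>R x)"
  unfolding continuous_on_def
proof
  fix s assume "s \<in> S"
  then have "(u \<longlongrightarrow> u s) (at s within S)" using assms by (simp add: continuous_on_def)
  from filterlim_compose[OF tendsto_scaleR_Pair filterlim_Pair[OF this tendsto_const[of x]]]
  show "((\<lambda>s. u s *\<^sub>R x) \<longlongrightarrow> u s *\<^sub>R x) (at s within S)" by simp
qed

lemma continuous_on_scaleR_right_tvs: "continuous_on S (\<lambda>x :: 'x::hausdorff_real_tvs. c *\<^sub>R x)"
  unfolding continuous_on_def
proof
  fix x :: 'x
  have "((\<lambda>y. y) \<longlongrightarrow> x) (at x within S)" by (rule tendsto_ident_at)
  from filterlim_compose[OF tendsto_scaleR_Pair filterlim_Pair[OF tendsto_const[of c] this]]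
  show "((\<lambda>x. c *\<^sub>R x) \<longlongrightarrow> c *\<^sub>R x) (at x within S)" by simp
qed

text \<open>Stick-breaking pulls the sets \<open>G y\<close> back to closed sets of the cube. The hypothesis on convex hulls
  is applied to those \<open>y\<close> whose weight does not vanish, so that the label found satisfies the
  boundary conditions of the cube.\<close>

lemma kkm_finite:
  fixes G :: "'x::hausdorff_real_tvs \<Rightarrow> 'x set"
  assumes fin: "finite S" and closed: "\<And>y. y \<in> S \<Longrightarrow> closed (G y)"
    and hull: "\<And>T. T \<subseteq> S \<Longrightarrow> T \<noteq> {} \<Longrightarrow> convex hull T \<subseteq> (\<Union>y\<in>T. G y)"
  shows "(\<Inter>y\<in>S. G y) \<noteq> {}"
proof (cases "S = {}")
  case False
  define n where "n = card S - 1"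
  have "card S = Suc n" using False fin by (simp add: n_def card_gt_0_iff)
  then obtain e where e: "bij_betw e {..n} S"
    using ex_bij_betw_nat_finite[OF fin] by (auto simp: atLeast0LessThan lessThan_Suc_atMost)
  then have eS: "e i \<in> S" if "i \<le> n" for i using that by (auto simp: bij_betw_def)
  define \<Phi> where "\<Phi> t = (\<Sum>i\<le>n. stick_breaking n t i *\<^sub>R e i)" for t
  have cont: "continuous_on UNIV \<Phi>"
    unfolding \<Phi>_def
    by (intro continuous_on_sum continuous_on_scaleR_tvs continuous_on_stick_breaking)
  obtain t where "\<And>i. i \<le> n \<Longrightarrow> t \<in> \<Phi> -` G (e i)"
  proof (rule kkm_cube[of n "\<lambda>i. \<Phi> -` G (e i)"])
    show "closed (\<Phi> -` G (e i))" if "i \<le> n" for i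
      using closed_vimage[OF closed[OF eS[OF that]] cont] .
    fix t :: "nat \<Rightarrow> real" assume t: "\<forall>j. t j \<in> {0..1}"
    let ?w = "stick_breaking n t"
    have w: "0 \<le> ?w i" for i using stick_breaking_nonneg t by blast
    let ?I = "{i. i \<le> n \<and> ?w i \<noteq> 0}"
    have sum1: "(\<Sum>i\<in>?I. ?w i) = 1"
      unfolding sum_stick_breaking[of n t, symmetric] by (rule sum.mono_neutral_left) auto
    then have ne: "?I \<noteq> {}" by (metis sum.empty zero_neq_one)
    have "\<Phi> t = (\<Sum>i\<in>?I. ?w i *\<^sub>R e i)"
      unfolding \<Phi>_def by (rule sum.mono_neutral_right) auto
    also have "\<dots> \<in> convex hull (e ` ?I)"
      by (rule convex_sum) (auto simp: sum1 w hull_inc)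
    finally have "\<Phi> t \<in> (\<Union>y\<in>e ` ?I. G y)"
      using hull[of "e ` ?I"] ne eS by blast
    then obtain i where i: "i \<le> n" "?w i \<noteq> 0" "\<Phi> t \<in> G (e i)" by auto
    then show "\<exists>i\<le>n. t \<in> \<Phi> -` G (e i) \<and> (i < n \<longrightarrow> t i \<noteq> 0) \<and> (\<forall>j<i. t j \<noteq> 1)"
      by (intro exI[of _ i]) (auto simp: stick_breaking_def)
  qed blast
  then have "\<Phi> t \<in> (\<Inter>y\<in>S. G y)" using e by (auto simp: bij_betw_def)
  then show ?thesis by blast
qed simp

theorem knaster_kuratowski_mazurkiewicz:
  fixes G :: "'x::hausdorff_real_tvs \<Rightarrow> 'x set"
  assumes closed: "\<And>y. y \<in> A \<Longrightarrow> closed (G y)"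
    and compact: "y0 \<in> A" "compact (G y0)"
    and hull: "\<And>S. finite S \<Longrightarrow> S \<subseteq> A \<Longrightarrow> S \<noteq> {} \<Longrightarrow> convex hull S \<subseteq> (\<Union>y\<in>S. G y)"
  shows "(\<Inter>y\<in>A. G y) \<noteq> {}"
proof -
  have "G y0 \<inter> (\<Inter>y\<in>A. G y) \<noteq> {}"
  proof (rule compact_imp_fip_image[OF compact(2) closed])
    fix S assume S: "finite S" "S \<subseteq> A"
    have "(\<Inter>y\<in>insert y0 S. G y) \<noteq> {}"
    proof (rule kkm_finite)
      fix T assume "T \<subseteq> insert y0 S" "T \<noteq> {}"
      then show "convex hull T \<subseteq> (\<Union>y\<in>T. G y)"
        using S compact(1) by (intro hull) (auto intro: finite_subset)
    qed (use S compact(1) closed in auto)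
    then show "G y0 \<inter> (\<Inter>y\<in>S. G y) \<noteq> {}" by simp
  qed
  then show ?thesis by blast
qed

section \<open>Cones and cone-convex maps\<close>

lemma mem_uminus_image: "(x :: 'a::group_add) \<in> uminus ` A \<longleftrightarrow> - x \<in> A"
  by force

lemma pointed_convex_coneD:
  assumes "pointed_convex_cone C"
  shows pointed_convex_cone_add: "x \<in> C \<Longrightarrow> y \<in> C \<Longrightarrow> x + y \<in> C"
    and pointed_convex_cone_scaleR: "x \<in> C \<Longrightarrow> 0 \<le> c \<Longrightarrow> c *\<^sub>R x \<in> C"
    and pointed_convex_cone_zero: "0 \<in> C"
  using assms by (auto simp: pointed_convex_cone_def cone_def)

lemma pointed_convex_cone_sum:
  assumes "pointed_convex_cone C" "\<And>i. i \<in> I \<Longrightarrow> h i \<in> C"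
  shows "(\<Sum>i\<in>I. h i) \<in> C"
  using assms(2)
  by (induction I rule: infinite_finite_induct)
    (auto intro: pointed_convex_cone_zero pointed_convex_cone_add assms(1))

text \<open>The translate of \<open>interior C\<close> by \<open>c\<close> is an open subset of \<open>C\<close>.\<close>

lemma interior_cone_add:
  fixes C :: "'z::hausdorff_real_tvs set"
  assumes C: "pointed_convex_cone C" and x: "x \<in> interior C" and c: "c \<in> C"
  shows "x + c \<in> interior C"
proof -
  let ?U = "(\<lambda>y. y - c) -` interior C"
  have "open ?U" by (intro open_vimage open_interior continuous_intros)
  moreover have "?U \<subseteq> C"
  proof
    fix y assume "y \<in> ?U"
    then have "(y - c) + c \<in> C"
      using interior_subset c by (intro pointed_convex_cone_add[OF C]) auto
    then show "y \<in> C" by simp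
  qed
  ultimately have "?U \<subseteq> interior C" by (rule interior_maximal[rotated])
  with x show ?thesis by auto
qed

lemma interior_cone_scaleR:
  fixes C :: "'z::hausdorff_real_tvs set"
  assumes C: "pointed_convex_cone C" and x: "x \<in> interior C" and t: "0 < t"
  shows "t *\<^sub>R x \<in> interior C"
proof -
  let ?U = "(\<lambda>y. inverse t *\<^sub>R y) -` interior C"
  have "open ?U" by (intro open_vimage open_interior continuous_on_scaleR_right_tvs)
  moreover have "?U \<subseteq> C"
  proof
    fix y assume "y \<in> ?U"
    then have "inverse t *\<^sub>R y \<in> C" using interior_subset by auto
    from pointed_convex_cone_scaleR[OF C this, of t] show "y \<in> C" using t by simp
  qed
  ultimately have "?U \<subseteq> interior C" by (rule interior_maximal[rotated])
  with x t show ?thesis by auto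
qed

lemma cone_convex_on_add:
  assumes C: "pointed_convex_cone C" and "cone_convex_on C K h" "cone_convex_on C K k"
  shows "cone_convex_on C K (\<lambda>y. h y + k y)"
  unfolding cone_convex_on_def
proof (intro ballI)
  fix x y and t :: real assume *: "x \<in> K" "y \<in> K" "t \<in> {0..1}"
  let ?m = "t *\<^sub>R x + (1 - t) *\<^sub>R y"
  have "(t *\<^sub>R h x + (1 - t) *\<^sub>R h y - h ?m) + (t *\<^sub>R k x + (1 - t) *\<^sub>R k y - k ?m) \<in> C"
    using assms(2,3) * unfolding cone_convex_on_def by (intro pointed_convex_cone_add[OF C]) auto
  then show "t *\<^sub>R (h x + k x) + (1 - t) *\<^sub>R (h y + k y) - (h ?m + k ?m) \<in> C"
    by (simp add: algebra_simps)
qed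

text \<open>Jensen's inequality for the order given by \<open>C\<close>: the epigraph of \<open>h\<close> is convex, so it contains the
  convex combinations of the points \<open>(y, h y)\<close>.\<close>

lemma cone_convex_on_jensen:
  assumes C: "pointed_convex_cone C" and K: "convex K" and h: "cone_convex_on C K h"
    and S: "finite S" "S \<subseteq> K" and u: "\<And>y. y \<in> S \<Longrightarrow> 0 \<le> u y" "sum u S = 1"
  shows "(\<Sum>y\<in>S. u y *\<^sub>R h y) - h (\<Sum>y\<in>S. u y *\<^sub>R y) \<in> C"
proof -
  let ?E = "{(y, z). y \<in> K \<and> z - h y \<in> C}"
  have "convex ?E"
    unfolding convex_alt
  proof (intro ballI allI impI)
    fix p q and t :: real
    assume pq: "p \<in> ?E" "q \<in> ?E" and "0 \<le> t \<and> t \<le> 1"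
    then have t: "0 \<le> t" "t \<le> 1" by simp_all
    obtain x a y b where p: "p = (x, a)" and q: "q = (y, b)" by fastforce
    with pq have *: "x \<in> K" "a - h x \<in> C" "y \<in> K" "b - h y \<in> C" by simp_all
    let ?m = "(1 - t) *\<^sub>R x + t *\<^sub>R y"
    have "(1 - t) *\<^sub>R h x + (1 - (1 - t)) *\<^sub>R h y
        - h ((1 - t) *\<^sub>R x + (1 - (1 - t)) *\<^sub>R y) \<in> C"
      using h[unfolded cone_convex_on_def, rule_format, OF *(1) *(3), of "1 - t"] t by simp
    then have conv: "(1 - t) *\<^sub>R h x + t *\<^sub>R h y - h ?m \<in> C" by simp
    have "(1 - t) *\<^sub>R (a - h x) + t *\<^sub>R (b - h y) \<in> C"
      using * t by (intro pointed_convex_cone_add[OF C] pointed_convex_cone_scaleR[OF C]) auto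
    then have "((1 - t) *\<^sub>R (a - h x) + t *\<^sub>R (b - h y))
        + ((1 - t) *\<^sub>R h x + t *\<^sub>R h y - h ?m) \<in> C"
      using conv by (rule pointed_convex_cone_add[OF C])
    moreover have "?m \<in> K" using K * t by (simp add: convex_alt)
    ultimately show "(1 - t) *\<^sub>R p + t *\<^sub>R q \<in> ?E"
      unfolding p q by (simp add: algebra_simps)
  qed
  then have "(\<Sum>y\<in>S. u y *\<^sub>R (y, h y)) \<in> ?E"
    using S u pointed_convex_cone_zero[OF C] by (intro convex_sum) auto
  moreover have "(\<Sum>y\<in>S. u y *\<^sub>R (y, h y)) = (\<Sum>y\<in>S. u y *\<^sub>R y, \<Sum>y\<in>S. u y *\<^sub>R h y)"
    by (simp add: sum_prod)
  ultimately show ?thesis by simp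
qed

section \<open>The equilibrium problem\<close>

text \<open>The definition indexes the points by \<open>{1..n}\<close>; convex hulls of finite sets come with weights indexed
  by the points themselves.\<close>

lemma essentially_quasimonotone_on_finite:
  assumes f: "essentially_quasimonotone_on C K f" and S: "finite S" "S \<subseteq> K"
    and u: "\<And>y. y \<in> S \<Longrightarrow> 0 \<le> u y" "sum u S = 1"
  shows "(\<Sum>y\<in>S. u y *\<^sub>R f (\<Sum>y\<in>S. u y *\<^sub>R y) y) \<notin> uminus ` interior C"
proof -
  obtain e where e: "bij_betw e {1..card S} S" using ex_bij_betw_nat_finite_1[OF S(1)] by blast
  have "\<forall>i\<in>{1..card S}. e i \<in> K \<and> 0 \<le> u (e i)"
    using e S u by (auto simp: bij_betw_def)
  moreover have "(\<Sum>i=1..card S. u (e i)) = 1"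
    unfolding sum.reindex_bij_betw[OF e, of u] by (rule u(2))
  ultimately have "(\<Sum>i=1..card S. u (e i) *\<^sub>R f (\<Sum>j=1..card S. u (e j) *\<^sub>R e j) (e i))
      \<notin> uminus ` interior C"
    by (intro f[unfolded essentially_quasimonotone_on_def, rule_format] conjI) simp_all
  then show ?thesis
    unfolding sum.reindex_bij_betw[OF e, of "\<lambda>y. u y *\<^sub>R y"]
      sum.reindex_bij_betw[OF e, of "\<lambda>y. u y *\<^sub>R f (\<Sum>y\<in>S. u y *\<^sub>R y) y"] .
qed

text \<open>Essential quasimonotonicity constrains only \<open>f\<close>. It transfers to \<open>f + g\<close> because \<open>C\<close>-convexity and
  \<open>g x x = 0\<close> make the averages of \<open>g x\<close> around \<open>x\<close> lie in \<open>C\<close>.\<close>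

lemma equilibrium_set_kkm:
  fixes C :: "'z::hausdorff_real_tvs set"
  assumes C: "pointed_convex_cone C" and K0: "convex K0"
    and f: "essentially_quasimonotone_on C K0 f"
    and g: "\<And>x. x \<in> K0 \<Longrightarrow> cone_convex_on C K0 (g x)" "\<And>x. x \<in> K0 \<Longrightarrow> g x x = 0"
    and S: "finite S" "S \<subseteq> K0"
  shows "convex hull S \<subseteq> (\<Union>y\<in>S. {x \<in> K0. f x y + g x y \<notin> uminus ` interior C})"
proof
  fix x assume "x \<in> convex hull S"
  then obtain u where u: "\<And>y. y \<in> S \<Longrightarrow> 0 \<le> u y" "sum u S = 1" and x: "x = (\<Sum>y\<in>S. u y *\<^sub>R y)"
    unfolding convex_hull_finite[OF S(1)] by auto
  have xK0: "x \<in> K0" unfolding x by (rule convex_sum[OF S(1) K0 u(2) u(1)]) (use S in auto)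
  have "\<exists>y\<in>S. f x y + g x y \<notin> uminus ` interior C"
  proof (rule ccontr)
    assume "\<not> ?thesis"
    then have neg: "- (f x y + g x y) \<in> interior C" if "y \<in> S" for y
      using that by (auto simp: mem_uminus_image)
    obtain k where k: "k \<in> S" "0 < u k"
      using u by (metis less_eq_real_def sum.neutral zero_neq_one)
    \<comment> \<open>Points of weight \<open>0\<close> contribute \<open>0\<close>, which need not be interior; one point of positive
      weight brings the whole sum into the interior.\<close>
    have "(\<Sum>y\<in>S - {k}. u y *\<^sub>R - (f x y + g x y)) \<in> C"
      using neg u interior_subset
      by (intro pointed_convex_cone_sum[OF C] pointed_convex_cone_scaleR[OF C]) auto
    then have "u k *\<^sub>R - (f x k + g x k) + (\<Sum>y\<in>S - {k}. u y *\<^sub>R - (f x y + g x y)) \<in> interior C"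
      using k neg by (intro interior_cone_add[OF C] interior_cone_scaleR[OF C]) auto
    then have "(\<Sum>y\<in>S. u y *\<^sub>R - (f x y + g x y)) \<in> interior C"
      using sum.remove[OF S(1) k(1), of "\<lambda>y. u y *\<^sub>R - (f x y + g x y)"] by simp
    moreover have "(\<Sum>y\<in>S. u y *\<^sub>R g x y) - g x x \<in> C"
      using cone_convex_on_jensen[OF C K0 g(1)[OF xK0] S u] unfolding x by simp
    ultimately have "(\<Sum>y\<in>S. u y *\<^sub>R - (f x y + g x y)) + ((\<Sum>y\<in>S. u y *\<^sub>R g x y) - g x x) \<in> interior C"
      by (rule interior_cone_add[OF C])
    moreover have "(\<Sum>y\<in>S. u y *\<^sub>R - (f x y + g x y)) + ((\<Sum>y\<in>S. u y *\<^sub>R g x y) - g x x)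
        = - (\<Sum>y\<in>S. u y *\<^sub>R f x y)"
      using g(2)[OF xK0] by (simp add: scaleR_diff_right scaleR_add_right sum.distrib sum_subtractf sum_negf)
    ultimately have "(\<Sum>y\<in>S. u y *\<^sub>R f x y) \<in> uminus ` interior C" by (simp add: mem_uminus_image)
    then show False using essentially_quasimonotone_on_finite[OF f S u] unfolding x by simp
  qed
  with xK0 show "x \<in> (\<Union>y\<in>S. {x \<in> K0. f x y + g x y \<notin> uminus ` interior C})" by blast
qed

text \<open>Along a net of points whose values avoid \<open>- interior C\<close>, the net \<open>z\<close> of upper bounds avoids this open
  set as well, hence so does its limit \<open>z\<^sub>0\<close>, and then so does \<open>h x\<close>, which lies above \<open>z\<^sub>0\<close>.\<close>

lemma closed_equilibrium_set:
  fixes C :: "'z::hausdorff_real_tvs set" and h :: "'x::hausdorff_real_tvs \<Rightarrow> 'z"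
  assumes C: "pointed_convex_cone C" and K0: "compact K0"
    and usc: "\<And>x (D :: ('x set \<times> 'x) set) le u. x \<in> K0 \<Longrightarrow> directed_set D le \<Longrightarrow>
      \<forall>a\<in>D. u a \<in> K0 \<Longrightarrow> (u \<longlongrightarrow> x) (tails D le) \<Longrightarrow>
      \<exists>(z :: 'x set \<times> 'x \<Rightarrow> 'z) z\<^sub>0. (z \<longlongrightarrow> z\<^sub>0) (tails D le) \<and>
         (\<forall>a\<in>D. h (u a) - z a \<in> uminus ` C) \<and> h x - z\<^sub>0 \<in> C"
  shows "closed {x \<in> K0. h x \<notin> uminus ` interior C}" (is "closed ?G")
proof -
  have "x \<in> ?G" if "x \<in> closure ?G" for x
  proof -
    from that obtain D :: "('x set \<times> 'x) set" and le u where dir: "directed_set D le"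
      and u: "\<forall>a\<in>D. u a \<in> ?G" and lim: "(u \<longlongrightarrow> x) (tails D le)"
      unfolding closure_iff_net by auto
    have "closure ?G \<subseteq> K0"
      by (rule closure_minimal) (use compact_imp_closed[OF K0] in auto)
    with that have xK0: "x \<in> K0" by blast
    obtain z z0 where z: "(z \<longlongrightarrow> z0) (tails D le)" "\<And>a. a \<in> D \<Longrightarrow> z a - h (u a) \<in> C"
      "h x - z0 \<in> C"
      using usc[OF xK0 dir _ lim] u by (auto simp: mem_uminus_image)
    have "h x \<notin> uminus ` interior C"
    proof
      assume "h x \<in> uminus ` interior C"
      then have "- h x + (h x - z0) \<in> interior C"
        using z by (intro interior_cone_add[OF C]) (auto simp: mem_uminus_image)
      then have "z0 \<in> uminus -` interior C" by simp
      moreover have "open (uminus -` interior C)"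
        by (intro open_vimage open_interior continuous_intros)
      ultimately obtain a where a: "a \<in> D" "\<forall>b\<in>D. le a b \<longrightarrow> - z b \<in> interior C"
        using z(1) unfolding net_tendsto_iff[OF dir] by (meson vimageD)
      have "le a a" using dir a(1) by (simp add: directed_set_def)
      with a have "- z a \<in> interior C" by blast
      then have "- z a + (z a - h (u a)) \<in> interior C"
        using z(2)[OF a(1)] by (rule interior_cone_add[OF C])
      then show False using u a(1) by (auto simp: mem_uminus_image)
    qed
    with xK0 show ?thesis by simp
  qed
  then have "closure ?G \<subseteq> ?G" by (rule subsetI)
  then show ?thesis by (simp add: closure_subset_eq)
qed

text \<open>If \<open>h y\<close> were in \<open>- interior C\<close>, a point \<open>w\<close> of \<open>K0\<close> on the half-open segment from \<open>y0\<close> to \<open>y\<close> would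
  have \<open>h w\<close> below a combination of \<open>h y\<close>, with positive weight, and of \<open>h y0\<close>, which is in \<open>- C\<close>. So
  \<open>h w\<close> would be in \<open>- interior C\<close> too.\<close>

lemma equilibrium_extends_from_core:
  fixes C :: "'z::hausdorff_real_tvs set"
  assumes C: "pointed_convex_cone C" and h: "cone_convex_on C K h" and K0: "K0 \<subseteq> K"
    and y0: "y0 \<in> core_rel K K0" "h y0 \<in> uminus ` C"
    and equi: "\<And>w. w \<in> K0 \<Longrightarrow> h w \<notin> uminus ` interior C"
    and y: "y \<in> K"
  shows "h y \<notin> uminus ` interior C"
proof
  assume neg: "h y \<in> uminus ` interior C"
  obtain t where t: "0 < t" "t \<le> 1" and w: "y0 + t *\<^sub>R (y - y0) \<in> K0"
    using y0(1) y unfolding core_rel_def left_open_segment_def by fastforce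
  have eq: "y0 + t *\<^sub>R (y - y0) = t *\<^sub>R y + (1 - t) *\<^sub>R y0" by (simp add: algebra_simps)
  let ?w = "t *\<^sub>R y + (1 - t) *\<^sub>R y0"
  have "y0 \<in> K" using y0(1) K0 by (auto simp: core_rel_def)
  then have "t *\<^sub>R h y + (1 - t) *\<^sub>R h y0 - h ?w \<in> C"
    using h y t unfolding cone_convex_on_def by auto
  moreover have "(1 - t) *\<^sub>R - h y0 \<in> C"
    using y0(2) t by (intro pointed_convex_cone_scaleR[OF C]) (auto simp: mem_uminus_image)
  moreover have "t *\<^sub>R - h y \<in> interior C"
    using neg t by (intro interior_cone_scaleR[OF C]) (auto simp: mem_uminus_image)
  ultimately have "t *\<^sub>R - h y + (1 - t) *\<^sub>R - h y0 + (t *\<^sub>R h y + (1 - t) *\<^sub>R h y0 - h ?w) \<in> interior C"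
    by (intro interior_cone_add[OF C])
  then have "h ?w \<in> uminus ` interior C" by (simp add: mem_uminus_image algebra_simps)
  then show False using equi[OF w] unfolding eq by simp
qed

theorem theorem5p7:
  fixes C :: "'z::hausdorff_real_tvs set"
    and K K0 :: "'x::hausdorff_real_tvs set"
    and f g :: "'x \<Rightarrow> 'x \<Rightarrow> 'z"
  assumes C: "pointed_convex_cone C" "interior C \<noteq> {}"
    and K: "K \<noteq> {}" "convex K"
    and K0: "K0 \<noteq> {}" "compact K0" "convex K0" "K0 \<subseteq> K"
    and i: "\<forall>x \<in> K0 - core_rel K K0. \<exists>y0 \<in> core_rel K K0. f x y0 + g x y0 \<in> uminus ` C"
    and ii: "\<forall>y\<in>K0. \<forall>x\<in>K0. \<forall>(D :: ('x set \<times> 'x) set) le u.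
      directed_set D le \<and> (\<forall>a\<in>D. u a \<in> K0) \<and> (u \<longlongrightarrow> x) (tails D le) \<longrightarrow>
      (\<exists>(z :: 'x set \<times> 'x \<Rightarrow> 'z) z\<^sub>0. (z \<longlongrightarrow> z\<^sub>0) (tails D le) \<and>
         (\<forall>a\<in>D. f (u a) y + g (u a) y - z a \<in> uminus ` C) \<and>
         f x y + g x y - z\<^sub>0 \<in> C)"
    and iii: "essentially_quasimonotone_on C K0 f"
    and iv: "\<forall>x\<in>K0. cone_convex_on C K (\<lambda>y. g x y) \<and> cone_convex_on C K (\<lambda>y. f x y)"
    and v: "\<forall>x\<in>K0. f x x \<in> uminus ` C - uminus ` interior C \<and> g x x = 0"
  shows "\<exists>x0\<in>K. \<forall>y\<in>K. f x0 y + g x0 y \<notin> uminus ` interior C"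
proof -
  have convex_f: "cone_convex_on C K (f x)" and convex_g: "cone_convex_on C K (g x)" if "x \<in> K0" for x
    using iv that by auto
  have sub: "cone_convex_on C K0 (g x)" if "x \<in> K0" for x
    using convex_g[OF that] K0(4) unfolding cone_convex_on_def by blast
  define G where "G y = {x \<in> K0. f x y + g x y \<notin> uminus ` interior C}" for y
  have closed_G: "closed (G y)" if "y \<in> K0" for y
    unfolding G_def using ii that by (intro closed_equilibrium_set[OF C(1) K0(2)]) blast
  obtain y1 where y1: "y1 \<in> K0" using K0(1) by blast
  have "(\<Inter>y\<in>K0. G y) \<noteq> {}"
  proof (rule knaster_kuratowski_mazurkiewicz[OF closed_G y1])
    have "G y1 = K0 \<inter> G y1" by (auto simp: G_def)
    then show "compact (G y1)" using compact_Int_closed[OF K0(2) closed_G[OF y1]] by simp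
    show "convex hull S \<subseteq> (\<Union>y\<in>S. G y)" if "finite S" "S \<subseteq> K0" for S
      unfolding G_def
      by (rule equilibrium_set_kkm[OF C(1) K0(3) iii sub _ that]) (use v in auto)
  qed
  then obtain x0 where x0: "x0 \<in> K0" "\<And>y. y \<in> K0 \<Longrightarrow> f x0 y + g x0 y \<notin> uminus ` interior C"
    using y1 unfolding G_def by blast
  obtain y0 where y0: "y0 \<in> core_rel K K0" "f x0 y0 + g x0 y0 \<in> uminus ` C"
  proof (cases "x0 \<in> core_rel K K0")
    case True
    then show thesis using that[of x0] v x0(1) by auto
  next
    case False
    then show thesis using that i x0(1) by blast
  qed
  have "f x0 y + g x0 y \<notin> uminus ` interior C" if "y \<in> K" for y
    using equilibrium_extends_from_core[OF C(1)
        cone_convex_on_add[OF C(1) convex_f[OF x0(1)] convex_g[OF x0(1)]] K0(4) y0 x0(2) that] .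
  with x0(1) K0(4) show ?thesis by blast
qed

end
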